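(* Let $\mathbf B\in\mathbb R^{n\times n}$ be invertible, $u_x,u_y\in\mathbb R^n$, and $I(x,y)=x^\top\mathbf By+x^\top u_x+u_y^\top y$ on $\mathbb R^n\times\mathbb R^n$. Let $L_H=\sqrt{\lambda_{\max}(\mathbf B^\top\mathbf B)}$, and let $z^*$ be the unique saddle point of $\min_x\max_yI(x,y)$. Run the updates given in the context with $\alpha_k=\frac{2}{k+2}$, $\eta_k=\frac{1}{2L_H}$ and $z_0^{\mathrm{ag}}=z_{-1/2}=z_0$. Then for every $K\ge1$ $$\|z_K^{\mathrm{ag}}-z^*\|^2\le\frac{64\,\lambda_{\max}(\mathbf B^\top\mathbf B)}{\lambda_{\min}(\mathbf B^\top\mathbf B)(K+1)^2}\|z_0-z^*\|^2 .$$ Moreover, with scheduled restarting (see context), a point $z$ with $\|z-z^*\|\le\varepsilon$ is obtained within a total number of iterations $$O\left(\sqrt{\frac{\lambda_{\max}(\mathbf B^\top\mathbf B)}{\lambda_{\min}(\mathbf B^\top\mathbf B)}}\,\log\left(\frac1\varepsilon\right)\right),$$ i.e. there is an absolute constant $C$ such that for every such problem and every initial point, for all sufficiently small $\varepsilon>0$, a suitable choice of epoch lengths and number of epochs achieves this with at most $C$ times the displayed quantity iterations.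
   Context: $\|\cdot\|$ is the Euclidean norm; $\lambda_{\max},\lambda_{\min}$ are the largest and smallest eigenvalues of a symmetric matrix. Write $z=[x;y]\in\mathbb R^{2n}$ and $H(z)=[\nabla_xI(x,y);-\nabla_yI(x,y)]=[\mathbf By+u_x;-\mathbf B^\top x-u_y]$; $z^*$ is the unique zero of $H$. Updates: for $k=0,1,2,\dots$, $z_{k+1/2}=z_k-\eta_kH(z_{k-1/2})$; $\ z_{k+1}^{\mathrm{ag}}=(1-\alpha_k)z_k^{\mathrm{ag}}+\alpha_kz_{k+1/2}$; $\ z_{k+1}=z_k-\eta_kH(z_{k+1/2})$. Scheduled restarting: the procedure is run in successive epochs; epoch $n$ runs the updates for $K_n$ iterations (with $k$ restarting from $0$) with $z_0^{\mathrm{ag}}=z_{-1/2}=z_0$ all set equal to the output $z^{\mathrm{ag}}_{K_{n-1}}$ of the previous epoch (the first epoch uses the given initial point); the output is that of the last epoch and the total number of iterations is $\sum_nK_n$. *)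

theory Defs
  imports Complex_Main "Jordan_Normal_Form.Spectral_Radius"
begin

text \<open>The dimension has to be an ordinary natural number, since the iteration bound is
  claimed with one constant for all dimensions. Hence the carrier-based vectors and matrices
  are used; a point \<open>z = [x; y]\<close> is a vector of dimension \<open>n + n\<close>.\<close>

definition euclidean_norm :: "real vec \<Rightarrow> real" where
  "euclidean_norm v = sqrt (v \<bullet> v)"

definition lambda_max :: "real mat \<Rightarrow> real" where
  "lambda_max A = Max (spectrum A)"

definition lambda_min :: "real mat \<Rightarrow> real" where
  "lambda_min A = Min (spectrum A)"

definition bilinear_problem :: "nat \<Rightarrow> real mat \<Rightarrow> real vec \<Rightarrow> real vec \<Rightarrow> bool" where
  "bilinear_problem n B ux uy \<longleftrightarrow>
     n \<ge> 1 \<and> B \<in> carrier_mat n n \<and> invertible_mat B \<and>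
     ux \<in> carrier_vec n \<and> uy \<in> carrier_vec n"

definition objective :: "real mat \<Rightarrow> real vec \<Rightarrow> real vec \<Rightarrow> real vec \<Rightarrow> real vec \<Rightarrow> real" where
  "objective B ux uy x y = x \<bullet> (B *\<^sub>v y) + x \<bullet> ux + uy \<bullet> y"

definition saddle_point :: "nat \<Rightarrow> real mat \<Rightarrow> real vec \<Rightarrow> real vec \<Rightarrow> real vec \<Rightarrow> bool" where
  "saddle_point n B ux uy z \<longleftrightarrow>
     z \<in> carrier_vec (n + n) \<and>
     (\<forall>x \<in> carrier_vec n. \<forall>y \<in> carrier_vec n.
        objective B ux uy (vec_first z n) y
          \<le> objective B ux uy (vec_first z n) (vec_last z n) \<and>
        objective B ux uy (vec_first z n) (vec_last z n)
          \<le> objective B ux uy x (vec_last z n))"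

text \<open>The vector field \<open>H z = [\<nabla>\<^sub>x I; - \<nabla>\<^sub>y I]\<close> of the objective \<open>I\<close>.\<close>

definition H_field :: "nat \<Rightarrow> real mat \<Rightarrow> real vec \<Rightarrow> real vec \<Rightarrow> real vec \<Rightarrow> real vec" where
  "H_field n B ux uy z =
     (B *\<^sub>v vec_last z n + ux) @\<^sub>v (- (transpose_mat B *\<^sub>v vec_first z n) - uy)"

text \<open>After \<open>k\<close> iterations the state is the triple \<open>(z\<^sub>k, z\<^bsub>k-1/2\<^esub>, z\<^sub>k\<^sup>a\<^sup>g)\<close>.\<close>

primrec iterates ::
  "(real vec \<Rightarrow> real vec) \<Rightarrow> (nat \<Rightarrow> real) \<Rightarrow> (nat \<Rightarrow> real) \<Rightarrow> real vec \<Rightarrow> nat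
    \<Rightarrow> real vec \<times> real vec \<times> real vec" where
  "iterates H \<eta> \<alpha> z0 0 = (z0, z0, z0)"
| "iterates H \<eta> \<alpha> z0 (Suc k) =
     (case iterates H \<eta> \<alpha> z0 k of (z, zhalf, zag) \<Rightarrow>
        let zhalf' = z - \<eta> k \<cdot>\<^sub>v H zhalf
        in (z - \<eta> k \<cdot>\<^sub>v H zhalf', zhalf', (1 - \<alpha> k) \<cdot>\<^sub>v zag + \<alpha> k \<cdot>\<^sub>v zhalf'))"

definition L_H :: "real mat \<Rightarrow> real" where
  "L_H B = sqrt (lambda_max (transpose_mat B * B))"

definition z_ag :: "nat \<Rightarrow> real mat \<Rightarrow> real vec \<Rightarrow> real vec \<Rightarrow> real vec \<Rightarrow> nat \<Rightarrow> real vec" where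
  "z_ag n B ux uy z0 K =
     snd (snd (iterates (H_field n B ux uy) (\<lambda>k. 1 / (2 * L_H B)) (\<lambda>k. 2 / (real k + 2)) z0 K))"

text \<open>Scheduled restarting; the list \<open>Ks\<close> contains the successive epoch lengths.\<close>

definition restarted :: "nat \<Rightarrow> real mat \<Rightarrow> real vec \<Rightarrow> real vec \<Rightarrow> real vec \<Rightarrow> nat list \<Rightarrow> real vec" where
  "restarted n B ux uy z0 Ks = foldl (\<lambda>z K. z_ag n B ux uy z K) z0 Ks"

end

theory Submission
  imports Defs "HOL-Analysis.L2_Norm" "HOL-Analysis.Function_Topology"
begin

text \<open>Put \<open>w = z - z\<^sup>*\<close>; then \<open>H z = M w\<close> with the skew block matrix \<open>M = [0, B; -B\<^sup>T, 0]\<close>, and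
  \<open>\<mu> \<parallel>v\<parallel>\<^sup>2 \<le> \<parallel>M v\<parallel>\<^sup>2 \<le> L\<^sup>2 \<parallel>v\<parallel>\<^sup>2\<close> for the extreme eigenvalues \<open>\<mu>\<close> and \<open>L\<^sup>2\<close> of \<open>B\<^sup>T B\<close>.
  With \<open>h\<^sub>k = z\<^bsub>k-1/2\<^esub> - z\<^sup>*\<close>, the potential \<open>\<parallel>w\<^sub>k\<parallel>\<^sup>2 + \<parallel>w\<^sub>k - h\<^sub>k\<parallel>\<^sup>2\<close> does not increase, so
  \<open>\<parallel>w\<^sub>k\<parallel> \<le> \<parallel>w\<^sub>0\<parallel>\<close>. The averaged point has weights proportional to \<open>k + 1\<close>, and \<open>M h\<^bsub>k+1\<^esub>\<close> is a multiple of
  \<open>w\<^sub>k - w\<^bsub>k+1\<^esub>\<close>; summation by parts makes its residual at most \<open>8 L \<parallel>w\<^sub>0\<parallel> / (K + 1)\<close>.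
  Epochs of length \<open>\<lceil>16 L / \<surd>\<mu>\<rceil>\<close> therefore halve the distance to \<open>z\<^sup>*\<close>.\<close>

section \<open>Euclidean norm\<close>

lemma euclidean_norm_eq_L2_set: "euclidean_norm v = L2_set (($) v) {0..<dim_vec v}"
  by (simp add: euclidean_norm_def L2_set_def scalar_prod_def power2_eq_square)

lemma euclidean_norm_nonneg [simp]: "0 \<le> euclidean_norm v"
  by (simp add: euclidean_norm_eq_L2_set)

lemma scalar_prod_self_nonneg [simp]: "0 \<le> v \<bullet> (v :: real vec)"
  by (simp add: scalar_prod_def sum_nonneg)

lemma euclidean_norm_square: "(euclidean_norm v)\<^sup>2 = v \<bullet> v"
  by (simp add: euclidean_norm_def)

lemma scalar_prod_self_eq_0_iff:
  assumes "v \<in> carrier_vec m"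
  shows "v \<bullet> (v :: real vec) = 0 \<longleftrightarrow> v = 0\<^sub>v m"
  using assms by (auto simp: scalar_prod_def sum_nonneg_eq_0_iff intro!: eq_vecI)

lemma euclidean_norm_smult: "euclidean_norm (c \<cdot>\<^sub>v v) = \<bar>c\<bar> * euclidean_norm v"
  by (simp add: euclidean_norm_def real_sqrt_mult mult.assoc[symmetric])

lemma euclidean_norm_triangle:
  assumes "v \<in> carrier_vec m" "w \<in> carrier_vec m"
  shows "euclidean_norm (v + w) \<le> euclidean_norm v + euclidean_norm w"
proof -
  have "L2_set (($) (v + w)) {0..<m} = L2_set (\<lambda>i. v $ i + w $ i) {0..<m}"
    using assms by (intro L2_set_cong) auto
  then show ?thesis
    using assms L2_set_triangle_ineq[of "($) v" "($) w" "{0..<m}"]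
    by (simp add: euclidean_norm_eq_L2_set)
qed

lemma scalar_prod_le_euclidean_norm:
  assumes "v \<in> carrier_vec m" "w \<in> carrier_vec m"
  shows "v \<bullet> w \<le> euclidean_norm v * euclidean_norm w"
proof -
  have "v \<bullet> w \<le> (\<Sum>i = 0..<m. \<bar>v $ i\<bar> * \<bar>w $ i\<bar>)"
    using assms by (auto simp: scalar_prod_def simp flip: abs_mult intro!: sum_mono)
  also have "\<dots> \<le> euclidean_norm v * euclidean_norm w"
    using assms L2_set_mult_ineq[of "($) v" "($) w" "{0..<m}"]
    by (simp add: euclidean_norm_eq_L2_set)
  finally show ?thesis .
qed

lemma scalar_prod_diff_self:
  assumes "v \<in> carrier_vec m" "w \<in> carrier_vec m"
  shows "(v - w) \<bullet> (v - w) = v \<bullet> v - 2 * (v \<bullet> w) + w \<bullet> (w :: real vec)"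
  using assms
  by (simp add: scalar_prod_def algebra_simps sum.distrib sum_subtractf sum_distrib_left)

text \<open>If \<open>a\<close> were positive, the linear term would win at small positive
  \<open>t\<close>. This serves as the first-order condition at a maximizer.\<close>

lemma quadratic_nonneg_imp_linear_coeff_nonpos:
  fixes a b :: real
  assumes "\<And>t. 0 \<le> t\<^sup>2 * b - 2 * t * a"
  shows "a \<le> 0"
proof (rule ccontr)
  assume "\<not> a \<le> 0"
  \<comment> \<open>The \<open>+ 1\<close> keeps the denominator positive even for
    \<open>b = 0\<close>.\<close>
  define t where "t = a / (\<bar>b\<bar> + 1)"
  have "t > 0" using \<open>\<not> a \<le> 0\<close> by (simp add: t_def)
  have "t * \<bar>b\<bar> < a * 2"
    using \<open>\<not> a \<le> 0\<close> by (simp add: t_def field_simps) (smt (verit) mult_nonneg_nonneg)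
  then have "t * b < 2 * a"
    using \<open>t > 0\<close> by (smt (verit) mult_left_mono)
  then have "t * (t * b) < t * (2 * a)"
    using \<open>t > 0\<close> by (rule mult_strict_left_mono)
  then show False
    using assms[of t] by (simp add: power2_eq_square algebra_simps)
qed

section \<open>The Rayleigh quotient of a symmetric matrix\<close>

text \<open>The sphere is a closed subset of a box whose factors are [-1, 1] below \<open>n\<close>
  and {0} from \<open>n\<close> on, and a product of compact sets is compact. Functions on
  \<open>nat\<close> carry the product topology while \<open>n\<close> remains an ordinary
  variable.\<close>

lemma compact_sphere_functions:
  "compact {x :: nat \<Rightarrow> real. (\<forall>i\<ge>n. x i = 0) \<and> (\<Sum>i<n. (x i)\<^sup>2) = 1}"
proof -
  define S where "S i = (if i < n then {-1..1} else {0 :: real})" for i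
  have "compactin (product_topology (\<lambda>_. euclidean) UNIV) (PiE UNIV S)"
    by (subst compactin_PiE) (auto simp: S_def)
  then have "compact (PiE UNIV S)"
    by (simp add: euclidean_product_topology)
  moreover have "closed {x :: nat \<Rightarrow> real. (\<Sum>i<n. (x i)\<^sup>2) = 1}"
    by (intro closed_Collect_eq continuous_intros) (auto intro: continuous_on_product_coordinates)
  ultimately have "compact (PiE UNIV S \<inter> {x :: nat \<Rightarrow> real. (\<Sum>i<n. (x i)\<^sup>2) = 1})"
    by (rule compact_Int_closed)
  also have "PiE UNIV S \<inter> {x :: nat \<Rightarrow> real. (\<Sum>i<n. (x i)\<^sup>2) = 1}
      = {x. (\<forall>i\<ge>n. x i = 0) \<and> (\<Sum>i<n. (x i)\<^sup>2) = 1}"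
  proof (intro equalityI subsetI)
    fix x :: "nat \<Rightarrow> real"
    assume x: "x \<in> {x. (\<forall>i\<ge>n. x i = 0) \<and> (\<Sum>i<n. (x i)\<^sup>2) = 1}"
    have "x i \<in> {-1..1}" if "i < n" for i
    proof -
      have "(x i)\<^sup>2 \<le> (\<Sum>i<n. (x i)\<^sup>2)"
        using that by (intro member_le_sum) auto
      then have "\<bar>x i\<bar> \<le> 1"
        using x by (simp add: abs_square_le_1)
      then show ?thesis by (simp add: abs_le_iff)
    qed
    then show "x \<in> PiE UNIV S \<inter> {x. (\<Sum>i<n. (x i)\<^sup>2) = 1}"
      using x by (auto simp: S_def)
  next
    fix x assume x: "x \<in> PiE UNIV S \<inter> {x. (\<Sum>i<n. (x i)\<^sup>2) = 1}"
    then have "x i \<in> S i" for i by (blast intro: PiE_mem)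
    then have "x i = 0" if "i \<ge> n" for i
      using that by (metis S_def not_less singletonD)
    then show "x \<in> {x. (\<forall>i\<ge>n. x i = 0) \<and> (\<Sum>i<n. (x i)\<^sup>2) = 1}"
      using x by simp
  qed
  finally show ?thesis .
qed

text \<open>The extreme value theorem on the function sphere, carried over to vectors by
  \<open>vec n\<close>.\<close>

lemma quadratic_form_attains_max:
  fixes A :: "real mat"
  assumes A: "A \<in> carrier_mat n n" and n: "n \<ge> 1"
  obtains v where "v \<in> carrier_vec n" "v \<bullet> v = 1"
    "\<And>w. w \<in> carrier_vec n \<Longrightarrow> w \<bullet> w = 1 \<Longrightarrow> w \<bullet> (A *\<^sub>v w) \<le> v \<bullet> (A *\<^sub>v v)"
proof -
  let ?S = "{x :: nat \<Rightarrow> real. (\<forall>i\<ge>n. x i = 0) \<and> (\<Sum>i<n. (x i)\<^sup>2) = 1}"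
  define q where "q x = (\<Sum>i<n. x i * (\<Sum>j<n. A $$ (i, j) * x j))" for x :: "nat \<Rightarrow> real"
  \<comment> \<open>The first unit vector shows that the sphere is nonempty; this is where
    \<open>n \<ge> 1\<close> enters.\<close>
  have "(\<lambda>i. if i = 0 then 1 else 0) \<in> ?S"
  proof -
    have "(\<Sum>i<n. (if i = 0 then 1 else 0 :: real)\<^sup>2) = (\<Sum>i<n. if i = 0 then 1 else 0)"
      by (intro sum.cong) auto
    then show ?thesis using n by (simp add: sum.delta)
  qed
  then have "?S \<noteq> {}" by (rule ex_in_conv[THEN iffD1, OF exI])
  moreover have "continuous_on ?S q"
    unfolding q_def
    by (intro continuous_intros) (auto intro: continuous_on_product_coordinates continuous_on_subset)
  ultimately have "\<exists>x\<in>?S. \<forall>y\<in>?S. q y \<le> q x"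
    by (rule continuous_attains_sup[OF compact_sphere_functions])
  then obtain x where x: "x \<in> ?S" and max: "\<forall>y\<in>?S. q y \<le> q x"
    by (rule bexE)
  have vec_q: "vec n y \<bullet> (A *\<^sub>v vec n y) = q y" for y
    using A by (simp add: q_def scalar_prod_def atLeast0LessThan)
  show ?thesis
  proof (rule that)
    show "vec n x \<bullet> vec n x = 1"
      using x by (simp add: scalar_prod_def atLeast0LessThan power2_eq_square)
    fix w :: "real vec" assume w: "w \<in> carrier_vec n" "w \<bullet> w = 1"
    define y where "y i = (if i < n then w $ i else 0)" for i
    have "w = vec n y" using w by (auto simp: y_def)
    moreover have "y \<in> ?S"
      using w by (auto simp: y_def scalar_prod_def atLeast0LessThan power2_eq_square)
    ultimately show "w \<bullet> (A *\<^sub>v w) \<le> vec n x \<bullet> (A *\<^sub>v vec n x)"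
      using max by (simp only: vec_q)
  qed simp
qed

text \<open>A maximizer of the Rayleigh quotient is an eigenvector: for its residual \<open>u\<close>, the form
  is nonnegative along \<open>v - t u\<close> only if \<open>u = 0\<close>.\<close>

lemma symmetric_quadratic_form_le_eigenvalue:
  fixes A :: "real mat"
  assumes A: "A \<in> carrier_mat n n" and sym: "transpose_mat A = A" and n: "n \<ge> 1"
  obtains e where "e \<in> spectrum A"
    "\<And>v. v \<in> carrier_vec n \<Longrightarrow> v \<bullet> (A *\<^sub>v v) \<le> e * (v \<bullet> v)"
proof -
  obtain v where v: "v \<in> carrier_vec n" "v \<bullet> v = 1"
    and max: "\<And>w. w \<in> carrier_vec n \<Longrightarrow> w \<bullet> w = 1 \<Longrightarrow> w \<bullet> (A *\<^sub>v w) \<le> v \<bullet> (A *\<^sub>v v)"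
    using quadratic_form_attains_max[OF A n] by blast
  define e where "e = v \<bullet> (A *\<^sub>v v)"
  have le: "w \<bullet> (A *\<^sub>v w) \<le> e * (w \<bullet> w)" if w: "w \<in> carrier_vec n" for w
  proof (cases "w \<bullet> w = 0")
    case True
    then have "w = 0\<^sub>v n" using w scalar_prod_self_eq_0_iff by blast
    then show ?thesis using A by simp
  next
    case False
    \<comment> \<open>Both sides are homogeneous of degree two, so it suffices to compare them after
      scaling \<open>w\<close> to the unit sphere.\<close>
    define c where "c = 1 / euclidean_norm w"
    have c: "c * c * (w \<bullet> w) = 1" "c * c > 0"
      using False by (auto simp: c_def euclidean_norm_def simp flip: power2_eq_square)
        (auto simp: power_divide order.strict_iff_order)
    have "(c \<cdot>\<^sub>v w) \<bullet> (A *\<^sub>v (c \<cdot>\<^sub>v w)) \<le> e"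
      unfolding e_def using w c by (intro max) (auto simp: mult.assoc)
    then have "c * c * (w \<bullet> (A *\<^sub>v w)) \<le> c * c * (w \<bullet> w) * e"
      using A w c by (simp add: mult_mat_vec[of A n n] mult.assoc)
    then have "c * c * (w \<bullet> (A *\<^sub>v w)) \<le> c * c * (e * (w \<bullet> w))"
      by (simp add: algebra_simps)
    then show ?thesis using c(2) by (rule mult_left_le_imp_le)
  qed
  define u where "u = e \<cdot>\<^sub>v v - A *\<^sub>v v"
  have u: "u \<in> carrier_vec n" using A v by (simp add: u_def)
  have Av: "A *\<^sub>v v \<in> carrier_vec n" "A *\<^sub>v u \<in> carrier_vec n" using A v u by auto
  have vAu: "v \<bullet> (A *\<^sub>v u) = u \<bullet> (A *\<^sub>v v)"
    using transpose_vec_mult_scalar[OF A u v(1)] comm_scalar_prod[OF u Av(1)] by (simp add: sym)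
  have uu: "u \<bullet> u = e * (u \<bullet> v) - u \<bullet> (A *\<^sub>v v)"
    using u v Av by (subst (2) u_def) (simp add: scalar_prod_minus_distrib[of _ n])
  \<comment> \<open>Along \<open>w = v - t u\<close> the slack
    \<open>e * (w \<bullet> w) - w \<bullet> (A *\<^sub>v w)\<close> vanishes at
    \<open>t = 0\<close>, and its linear coefficient in \<open>t\<close> is
    \<open>- 2 * (u \<bullet> u)\<close>.\<close>
  have "u \<bullet> u \<le> 0"
  proof (rule quadratic_nonneg_imp_linear_coeff_nonpos)
    fix t :: real
    define w where "w = v - t \<cdot>\<^sub>v u"
    have Aw: "A *\<^sub>v w = A *\<^sub>v v - t \<cdot>\<^sub>v (A *\<^sub>v u)"
      unfolding w_def using A u v
      by (subst mult_minus_distrib_mat_vec[of _ n n]) (auto simp: mult_mat_vec[of A n n])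
    have "w \<bullet> (A *\<^sub>v w) = v \<bullet> (A *\<^sub>v v) - t * (v \<bullet> (A *\<^sub>v u)) - t * (u \<bullet> (A *\<^sub>v v))
        + t\<^sup>2 * (u \<bullet> (A *\<^sub>v u))"
      unfolding Aw unfolding w_def using u v Av
      by (simp add: scalar_prod_minus_distrib[of _ n] minus_scalar_prod_distrib[of _ n] power2_eq_square
          algebra_simps)
    also have "\<dots> = e - 2 * t * (u \<bullet> (A *\<^sub>v v)) + t\<^sup>2 * (u \<bullet> (A *\<^sub>v u))"
      by (simp add: vAu e_def)
    finally have 1: "w \<bullet> (A *\<^sub>v w) = e - 2 * t * (u \<bullet> (A *\<^sub>v v)) + t\<^sup>2 * (u \<bullet> (A *\<^sub>v u))" .
    have 2: "w \<bullet> w = 1 - 2 * t * (u \<bullet> v) + t\<^sup>2 * (u \<bullet> u)"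
      unfolding w_def using u v comm_scalar_prod[of u n v]
      by (subst scalar_prod_diff_self[of _ n]) (auto simp: power2_eq_square)
    have "w \<bullet> (A *\<^sub>v w) \<le> e * (w \<bullet> w)"
      using u v by (intro le) (simp add: w_def)
    then show "0 \<le> t\<^sup>2 * (e * (u \<bullet> u) - u \<bullet> (A *\<^sub>v u)) - 2 * t * (u \<bullet> u)"
      by (subst (2) uu) (simp add: 1 2 algebra_simps)
  qed
  then have "u = 0\<^sub>v n"
    using u scalar_prod_self_nonneg[of u] scalar_prod_self_eq_0_iff by (metis order_antisym)
  have "A *\<^sub>v v = e \<cdot>\<^sub>v v"
  proof (rule eq_vecI)
    fix i assume i: "i < dim_vec (e \<cdot>\<^sub>v v)"
    then have "u $ i = 0" using \<open>u = 0\<^sub>v n\<close> v by simp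
    then show "(A *\<^sub>v v) $ i = (e \<cdot>\<^sub>v v) $ i" 
      using i A v Av by (simp add: u_def)
  qed (use A v in auto)
  moreover have "v \<noteq> 0\<^sub>v n" using v by auto
  ultimately have "e \<in> spectrum A"
    using A v by (auto simp: spectrum_def eigenvalue_def eigenvector_def)
  then show ?thesis using le that by blast
qed

lemma lambda_max_bound:
  assumes A: "A \<in> carrier_mat n n" and sym: "transpose_mat A = A" and n: "n \<ge> 1"
    and v: "v \<in> carrier_vec n"
  shows "v \<bullet> (A *\<^sub>v v) \<le> lambda_max A * (v \<bullet> v)"
proof -
  obtain e where e: "e \<in> spectrum A" "v \<bullet> (A *\<^sub>v v) \<le> e * (v \<bullet> v)"
    using symmetric_quadratic_form_le_eigenvalue[OF A sym n] v by metis
  moreover have "e \<le> lambda_max A"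
    unfolding lambda_max_def using e(1) card_finite_spectrum[OF A] by simp
  ultimately show ?thesis
    using mult_right_mono[of e "lambda_max A" "v \<bullet> v"] by simp
qed

lemma spectrum_uminus_iff:
  fixes A :: "real mat"
  assumes A: "A \<in> carrier_mat n n"
  shows "e \<in> spectrum (- A) \<longleftrightarrow> - e \<in> spectrum A"
proof -
  have "(- A) *\<^sub>v v = e \<cdot>\<^sub>v v \<longleftrightarrow> A *\<^sub>v v = (- e) \<cdot>\<^sub>v v" if "v \<in> carrier_vec n" for v
    using A that by (auto simp: vec_eq_iff minus_equation_iff)
  then show ?thesis
    using A unfolding spectrum_def eigenvalue_def eigenvector_def by (auto simp del: uminus_mult_mat_vec)
qed

lemma spectrum_nonempty_symmetric:
  fixes A :: "real mat"
  assumes A: "A \<in> carrier_mat n n" and sym: "transpose_mat A = A" and n: "n \<ge> 1"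
  shows "spectrum A \<noteq> {}"
  using symmetric_quadratic_form_le_eigenvalue[OF A sym n] by (metis empty_iff)

text \<open>The upper bound for the form of \<open>- A\<close>, whose spectrum is the negated
  spectrum of \<open>A\<close>.\<close>

lemma lambda_min_bound:
  assumes A: "A \<in> carrier_mat n n" and sym: "transpose_mat A = A" and n: "n \<ge> 1"
    and v: "v \<in> carrier_vec n"
  shows "lambda_min A * (v \<bullet> v) \<le> v \<bullet> (A *\<^sub>v v)"
proof -
  have "- A \<in> carrier_mat n n" "transpose_mat (- A) = - A"
    using A sym by (simp_all add: transpose_uminus)
  then obtain e where e: "e \<in> spectrum (- A)" "v \<bullet> ((- A) *\<^sub>v v) \<le> e * (v \<bullet> v)"
    using symmetric_quadratic_form_le_eigenvalue[of "- A" n] n v by metis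
  have "lambda_min A \<le> - e"
    unfolding lambda_min_def using e(1) card_finite_spectrum[OF A] spectrum_uminus_iff[OF A] by simp
  moreover have "v \<bullet> ((- A) *\<^sub>v v) = - (v \<bullet> (A *\<^sub>v v))"
    using A v by simp
  ultimately show ?thesis
    using e(2) mult_right_mono[of "lambda_min A" "- e" "v \<bullet> v"] by simp
qed

section \<open>Optimistic iteration for a skew linear field\<close>

text \<open>The residual estimate uses only skewness and the operator norm bound \<open>L\<close>;
  the smallest eigenvalue enters later, when residuals are turned into distances. The solution is
  shifted to the origin.\<close>

locale skew_bounded =
  fixes M :: "real mat" and m :: nat and L :: real
  assumes M_carrier: "M \<in> carrier_mat m m"
    and skew: "v \<in> carrier_vec m \<Longrightarrow> v \<bullet> (M *\<^sub>v v) = 0"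
    and bounded: "v \<in> carrier_vec m \<Longrightarrow> (M *\<^sub>v v) \<bullet> (M *\<^sub>v v) \<le> L\<^sup>2 * (v \<bullet> v)"
    and L_pos: "0 < L"
begin

definition iters :: "real vec \<Rightarrow> nat \<Rightarrow> real vec \<times> real vec \<times> real vec" where
  "iters = iterates ((*\<^sub>v) M) (\<lambda>_. 1 / (2 * L)) (\<lambda>k. 2 / (real k + 2))"

lemma mult_closed [simp]: "v \<in> carrier_vec m \<Longrightarrow> M *\<^sub>v v \<in> carrier_vec m"
  using M_carrier by simp

text \<open>The potential of optimistic gradient descent-ascent. With \<open>a = \<eta> M h\<close> and
  \<open>b = \<eta> M h'\<close>, skewness gives \<open>b \<bullet> w = b \<bullet> a\<close>, so both potentials are
  compared through \<open>a - b = w' - h'\<close>.\<close>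

lemma optimistic_step_potential:
  assumes w: "w \<in> carrier_vec m" and h: "h \<in> carrier_vec m"
    and h': "h' = w - (1 / (2 * L)) \<cdot>\<^sub>v (M *\<^sub>v h)"
    and w': "w' = w - (1 / (2 * L)) \<cdot>\<^sub>v (M *\<^sub>v h')"
  shows "w' \<bullet> w' + (w' - h') \<bullet> (w' - h') \<le> w \<bullet> w + (w - h) \<bullet> (w - h)"
proof -
  define a where "a = (1 / (2 * L)) \<cdot>\<^sub>v (M *\<^sub>v h)"
  define b where "b = (1 / (2 * L)) \<cdot>\<^sub>v (M *\<^sub>v h')"
  have a: "a \<in> carrier_vec m" using h by (simp add: a_def)
  have h'_eq: "h' = w - a" and w'_eq: "w' = w - b" using h' w' by (simp_all add: a_def b_def)
  have h'_closed: "h' \<in> carrier_vec m" using w a by (simp add: h'_eq)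
  have b: "b \<in> carrier_vec m" using h'_closed by (simp add: b_def)
  have "h' \<bullet> b = 0" using h'_closed skew[of h'] by (simp add: b_def)
  then have wb: "w \<bullet> b = a \<bullet> b"
    using w a b by (simp add: h'_eq minus_scalar_prod_distrib[of _ m])
  have "b - a = (1 / (2 * L)) \<cdot>\<^sub>v (M *\<^sub>v (h' - h))"
    using M_carrier h h'_closed
    by (intro eq_vecI) (auto simp: a_def b_def mult_minus_distrib_mat_vec[of _ m m] algebra_simps)
  then have "(b - a) \<bullet> (b - a)
      = (1 / (2 * L))\<^sup>2 * ((M *\<^sub>v (h' - h)) \<bullet> (M *\<^sub>v (h' - h)))"
    using h h'_closed by (simp add: power2_eq_square)
  \<comment> \<open>The step size is chosen for this point: it cancels \<open>L\<close> and leaves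
    the contraction factor 1/4 for squared norms.\<close>
  also have "\<dots> \<le> (1 / (2 * L))\<^sup>2 * (L\<^sup>2 * ((h' - h) \<bullet> (h' - h)))"
    using h h'_closed by (intro mult_left_mono bounded) auto
  also have "\<dots> = ((h' - h) \<bullet> (h' - h)) / 4"
    using L_pos by (simp add: field_simps power2_eq_square)
  finally have 1: "4 * ((b - a) \<bullet> (b - a)) \<le> (h' - h) \<bullet> (h' - h)" by simp
  have "h' - h = (w - h) - a" using w h a by (intro eq_vecI) (auto simp: h'_eq)
  then have 2: "(h' - h) \<bullet> (h' - h) = (w - h) \<bullet> (w - h) - 2 * ((w - h) \<bullet> a) + a \<bullet> a"
    using w h a by (simp add: scalar_prod_diff_self[of _ m])
  have "0 \<le> ((w - h) + a) \<bullet> ((w - h) + a)" by simp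
  also have "\<dots> = (w - h) \<bullet> (w - h) + 2 * ((w - h) \<bullet> a) + a \<bullet> a"
    using w h a comm_scalar_prod[of a m "w - h"]
    by (simp add: scalar_prod_add_distrib[of _ m] add_scalar_prod_distrib[of _ m])
  finally have 3: "- 2 * ((w - h) \<bullet> a) \<le> (w - h) \<bullet> (w - h) + a \<bullet> a" by simp
  have "w' - h' = - (b - a)" using w a b by (intro eq_vecI) (auto simp: w'_eq h'_eq)
  then have 4: "(w' - h') \<bullet> (w' - h') = (b - a) \<bullet> (b - a)" using a b by simp
  have 5: "w' \<bullet> w' = w \<bullet> w - 2 * (a \<bullet> b) + b \<bullet> b"
    using w b by (simp add: w'_eq scalar_prod_diff_self[of _ m] wb)
  have 6: "(b - a) \<bullet> (b - a) = b \<bullet> b - 2 * (a \<bullet> b) + a \<bullet> a"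
    using a b comm_scalar_prod[OF a b] by (simp add: scalar_prod_diff_self[of _ m])
  \<comment> \<open>By 4, 5 and 6 the left side is \<open>w \<bullet> w + 2 * ((b - a) \<bullet> (b
    - a)) - a \<bullet> a\<close>. By 1, 2 and 3 its middle term is at most
    \<open>(w - h) \<bullet> (w - h) + a \<bullet> a\<close>.\<close>
  show ?thesis using 1 2 3 4 5 6 by linarith
qed

text \<open>The potential starts at \<open>w0 \<bullet> w0\<close>, since the initial half point
  coincides with the initial point, and no step increases it.\<close>

lemma iters_bounded:
  assumes "w0 \<in> carrier_vec m" "iters w0 k = (w, h, a)"
  shows "w \<in> carrier_vec m \<and> h \<in> carrier_vec m \<and> a \<in> carrier_vec m \<and>
    w \<bullet> w + (w - h) \<bullet> (w - h) \<le> w0 \<bullet> w0"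
  using assms(2)
proof (induction k arbitrary: w h a)
  case 0
  then show ?case using assms(1) by (auto simp: iters_def)
next
  case (Suc k)
  obtain v g b where s: "iters w0 k = (v, g, b)" by (metis prod_cases3)
  note IH = Suc.IH[OF s]
  have eqs: "h = v - (1 / (2 * L)) \<cdot>\<^sub>v (M *\<^sub>v g)" "w = v - (1 / (2 * L)) \<cdot>\<^sub>v (M *\<^sub>v h)"
    "a = (1 - 2 / (real k + 2)) \<cdot>\<^sub>v b + (2 / (real k + 2)) \<cdot>\<^sub>v h"
    using Suc.prems s by (auto simp: iters_def Let_def)
  have h: "h \<in> carrier_vec m" using IH by (simp add: eqs(1))
  have w: "w \<in> carrier_vec m" using IH h by (simp add: eqs(2))
  have a: "a \<in> carrier_vec m" using IH h by (simp add: eqs(3))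
  show ?case
    using optimistic_step_potential[OF _ _ eqs(1,2)] IH h w a by force
qed

lemma iters_norm_le:
  assumes "w0 \<in> carrier_vec m" "iters w0 k = (w, h, a)"
  shows "euclidean_norm w \<le> euclidean_norm w0"
proof -
  have "w \<bullet> w + (w - h) \<bullet> (w - h) \<le> w0 \<bullet> w0"
    using iters_bounded[OF assms] by blast
  then have "w \<bullet> w \<le> w0 \<bullet> w0"
    using scalar_prod_self_nonneg[of "w - h"] by linarith
  then show ?thesis by (simp add: euclidean_norm_def)
qed

text \<open>Since \<open>M h\<^bsub>k+1\<^esub> = 2 L (w\<^sub>k - w\<^bsub>k+1\<^esub>)\<close>, the weighted sum \<open>k (k + 1) M a\<^sub>k\<close> telescopes by parts
  to \<open>4 L (w\<^sub>0 + \<dots> + w\<^bsub>k-1\<^esub> - k w\<^sub>k)\<close>.\<close>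

lemma iters_average:
  assumes w0: "w0 \<in> carrier_vec m" and "iters w0 k = (w, h, a)"
  shows "euclidean_norm ((real k * (real k + 1)) \<cdot>\<^sub>v (M *\<^sub>v a) + (4 * L * real k) \<cdot>\<^sub>v w)
    \<le> 4 * L * real k * euclidean_norm w0"
  using assms(2)
proof (induction k arbitrary: w h a)
  case 0
  then have "w = w0" "a = w0" by (auto simp: iters_def)
  moreover have "(0 \<cdot>\<^sub>v (M *\<^sub>v w0) + 0 \<cdot>\<^sub>v w0) = 0\<^sub>v m"
    using w0 M_carrier by (intro eq_vecI) auto
  ultimately show ?case by (simp add: euclidean_norm_def)
next
  case (Suc k)
  obtain v g b where s: "iters w0 k = (v, g, b)" by (metis prod_cases3)
  have v: "v \<in> carrier_vec m" "g \<in> carrier_vec m" "b \<in> carrier_vec m"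
    and h: "h \<in> carrier_vec m"
    using iters_bounded[OF w0 s] iters_bounded[OF w0 Suc.prems] by auto
  have eqs: "w = v - (1 / (2 * L)) \<cdot>\<^sub>v (M *\<^sub>v h)"
    "a = (1 - 2 / (real k + 2)) \<cdot>\<^sub>v b + (2 / (real k + 2)) \<cdot>\<^sub>v h"
    using Suc.prems s by (auto simp: iters_def Let_def)
  have Ma: "M *\<^sub>v a = (1 - 2 / (real k + 2)) \<cdot>\<^sub>v (M *\<^sub>v b) + (2 / (real k + 2)) \<cdot>\<^sub>v (M *\<^sub>v h)"
    unfolding eqs(2) using M_carrier v h
    by (simp add: mult_add_distrib_mat_vec[of _ m m] mult_mat_vec[of _ m m])
  have Mbh: "M *\<^sub>v b \<in> carrier_vec m" "M *\<^sub>v h \<in> carrier_vec m" using v h by auto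
  \<comment> \<open>The summation by parts in one coordinate, with \<open>x\<close>,
    \<open>y\<close>, \<open>t\<close> for \<open>M b\<close>, \<open>M h\<close>, \<open>v\<close>.
    The averaging contributes \<open>2 * (k + 1) * y\<close> and the step from \<open>v\<close> to
    \<open>w\<close> contributes the negative of it, so \<open>y\<close> drops out.\<close>
  have coord: "(real k + 1) * (real k + 2) * ((1 - 2 / (real k + 2)) * x + 2 / (real k + 2) * y)
      + 4 * L * (real k + 1) * (t - 1 / (2 * L) * y)
      = real k * (real k + 1) * x + 4 * L * real k * t + 4 * L * t" for x y t :: real
  proof -
    have "d * (1 - 2 / d) = d - 2" "d * (2 / d) = 2" if "d \<noteq> 0" for d :: real
      using that by (simp_all add: right_diff_distrib)
    moreover have "real k + 2 \<noteq> 0" by linarith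
    ultimately have "(real k + 2) * (1 - 2 / (real k + 2)) = real k" "(real k + 2) * (2 / (real k + 2)) = 2"
      by (metis add_diff_cancel_right')+
    then have 1: "(real k + 2) * ((1 - 2 / (real k + 2)) * x + 2 / (real k + 2) * y) = real k * x + 2 * y"
      by (simp only: distrib_left mult.assoc[symmetric])
    have 2: "L * (t - 1 / (2 * L) * y) = L * t - y / 2"
      using L_pos by (simp add: field_simps)
    have "?thesis \<longleftrightarrow> (real k + 1) * (real k * x + 2 * y) + 4 * (real k + 1) * (L * t - y / 2)
        = real k * (real k + 1) * x + 4 * L * real k * t + 4 * L * t"
      unfolding 1[symmetric] 2[symmetric] by (simp only: ac_simps)
    then show ?thesis by (simp add: algebra_simps)
  qed
  let ?p = "(real k * (real k + 1)) \<cdot>\<^sub>v (M *\<^sub>v b) + (4 * L * real k) \<cdot>\<^sub>v v"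
  have "((real k + 1) * (real k + 2)) \<cdot>\<^sub>v (M *\<^sub>v a) + (4 * L * (real k + 1)) \<cdot>\<^sub>v w
      = ?p + (4 * L) \<cdot>\<^sub>v v" (is "?l = ?r")
  proof (rule eq_vecI)
    fix i assume "i < dim_vec ?r"
    then have i: "i < m" using v by simp
    show "?l $ i = ?r $ i"
      using i v(1) Mbh M_carrier coord[of "(M *\<^sub>v b) $ i" "(M *\<^sub>v h) $ i" "v $ i"]
      by (simp add: Ma eqs(1) del: index_mult_mat_vec)
  qed (use v Mbh M_carrier in \<open>simp add: Ma eqs(1)\<close>)
  then have "euclidean_norm ?l \<le> euclidean_norm ?p + euclidean_norm ((4 * L) \<cdot>\<^sub>v v)"
    using euclidean_norm_triangle[of ?p m "(4 * L) \<cdot>\<^sub>v v"] v Mbh by simp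
  \<comment> \<open>The only new term is \<open>4 * L\<close> times an iterate, and iterates never
    exceed \<open>w0\<close> in norm.\<close>
  also have "\<dots> \<le> 4 * L * real k * euclidean_norm w0 + 4 * L * euclidean_norm w0"
    using Suc.IH[OF s] iters_norm_le[OF w0 s] L_pos
    by (intro add_mono) (simp_all add: euclidean_norm_smult)
  finally show ?case by (simp add: algebra_simps)
qed

text \<open>Removing the multiple of \<open>w\<close> from the averaged estimate doubles the
  constant 4 to 8. One factor \<open>k\<close> then cancels, which requires
  \<open>k \<ge> 1\<close>.\<close>

lemma iters_average_residual:
  assumes w0: "w0 \<in> carrier_vec m" and k: "k \<ge> 1"
  shows "euclidean_norm (M *\<^sub>v snd (snd (iters w0 k))) \<le> 8 * L / (real k + 1) * euclidean_norm w0"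
proof -
  obtain w h a where s: "iters w0 k = (w, h, a)" by (metis prod_cases3)
  have c: "w \<in> carrier_vec m" "M *\<^sub>v a \<in> carrier_vec m"
    using iters_bounded[OF w0 s] by auto
  let ?p = "(real k * (real k + 1)) \<cdot>\<^sub>v (M *\<^sub>v a) + (4 * L * real k) \<cdot>\<^sub>v w"
  have "(real k * (real k + 1)) \<cdot>\<^sub>v (M *\<^sub>v a) = ?p + (- (4 * L * real k)) \<cdot>\<^sub>v w"
    using c M_carrier by (intro eq_vecI) auto
  then have "real k * (real k + 1) * euclidean_norm (M *\<^sub>v a)
      \<le> euclidean_norm ?p + euclidean_norm ((- (4 * L * real k)) \<cdot>\<^sub>v w)"
    using euclidean_norm_triangle[of ?p m "(- (4 * L * real k)) \<cdot>\<^sub>v w"] c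
      euclidean_norm_smult[of "real k * (real k + 1)" "M *\<^sub>v a"] by simp
  also have "\<dots> \<le> 4 * L * real k * euclidean_norm w0 + 4 * L * real k * euclidean_norm w0"
  proof -
    have "4 * L * real k * euclidean_norm w \<le> 4 * L * real k * euclidean_norm w0"
      using iters_norm_le[OF w0 s] L_pos by (intro mult_left_mono) auto
    moreover have "\<bar>- (4 * L * real k)\<bar> = 4 * L * real k" using L_pos by simp
    ultimately show ?thesis
      using iters_average[OF w0 s] by (auto simp only: euclidean_norm_smult intro!: add_mono)
  qed
  finally have "real k * ((real k + 1) * euclidean_norm (M *\<^sub>v a)) \<le> real k * (8 * L * euclidean_norm w0)"
    by (simp add: algebra_simps)
  then have "(real k + 1) * euclidean_norm (M *\<^sub>v a) \<le> 8 * L * euclidean_norm w0"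
    using k by (simp add: mult_le_cancel_left)
  then show ?thesis by (simp add: s field_simps)
qed

text \<open>Translation by \<open>zs\<close> commutes with the gradient steps, and with the
  averaging because its weights sum to 1. The carrier facts are part of the induction since
  \<open>H\<close> is known only on the carrier.\<close>

lemma iterates_eq_iters:
  assumes H: "\<And>z. z \<in> carrier_vec m \<Longrightarrow> H z = M *\<^sub>v (z - zs)"
    and zs: "zs \<in> carrier_vec m" and z0: "z0 \<in> carrier_vec m"
    and "iterates H (\<lambda>_. 1 / (2 * L)) (\<lambda>k. 2 / (real k + 2)) z0 k = (z, h, a)"
  shows "z \<in> carrier_vec m \<and> h \<in> carrier_vec m \<and> a \<in> carrier_vec m \<and>
    iters (z0 - zs) k = (z - zs, h - zs, a - zs)"
  using assms(4)
proof (induction k arbitrary: z h a)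
  case 0
  then show ?case using z0 by (auto simp: iters_def)
next
  case (Suc k)
  obtain v g b
    where s: "iterates H (\<lambda>_. 1 / (2 * L)) (\<lambda>k. 2 / (real k + 2)) z0 k = (v, g, b)"
    by (metis prod_cases3)
  note IH = Suc.IH[OF s]
  have c: "v \<in> carrier_vec m" "g \<in> carrier_vec m" "b \<in> carrier_vec m" using IH by auto
  have eqs: "h = v - (1 / (2 * L)) \<cdot>\<^sub>v (M *\<^sub>v (g - zs))"
    "a = (1 - 2 / (real k + 2)) \<cdot>\<^sub>v b + (2 / (real k + 2)) \<cdot>\<^sub>v h"
    using Suc.prems s c by (auto simp: Let_def H)
  have h: "h \<in> carrier_vec m" using c zs by (simp add: eqs(1))
  have z: "z = v - (1 / (2 * L)) \<cdot>\<^sub>v (M *\<^sub>v (h - zs))"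
    using Suc.prems s h by (auto simp: Let_def H)
  have shift: "v - y - zs = v - zs - y" if "y \<in> carrier_vec m" for y
    using c zs that by (intro eq_vecI) auto
  have "h - zs = (v - zs) - (1 / (2 * L)) \<cdot>\<^sub>v (M *\<^sub>v (g - zs))"
    using c zs by (simp add: eqs(1) shift)
  moreover have "z - zs = (v - zs) - (1 / (2 * L)) \<cdot>\<^sub>v (M *\<^sub>v (h - zs))"
    using h zs by (simp add: z shift)
  moreover have "a - zs
      = (1 - 2 / (real k + 2)) \<cdot>\<^sub>v (b - zs) + (2 / (real k + 2)) \<cdot>\<^sub>v (h - zs)"
    unfolding eqs(2) using c(3) h zs by (intro eq_vecI) (auto simp: algebra_simps diff_divide_distrib)
  ultimately have "iters (z0 - zs) (Suc k) = (z - zs, h - zs, a - zs)"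
    using IH by (simp add: iters_def Let_def)
  then show ?case using c h zs by (simp add: z eqs(2))
qed

end

section \<open>Bilinear saddle points\<close>

lemma cauchy_schwarz_square:
  fixes v w :: "real vec"
  assumes "v \<in> carrier_vec m" "w \<in> carrier_vec m" "0 \<le> v \<bullet> w"
  shows "(v \<bullet> w)\<^sup>2 \<le> (v \<bullet> v) * (w \<bullet> w)"
  using power_mono[OF scalar_prod_le_euclidean_norm[OF assms(1,2)] assms(3), of 2]
  by (simp add: power_mult_distrib euclidean_norm_square)

lemma vec_first_append: "x \<in> carrier_vec n \<Longrightarrow> vec_first (x @\<^sub>v y) n = x"
  by (intro eq_vecI) (auto simp: vec_first_def)

lemma vec_last_append: "y \<in> carrier_vec n \<Longrightarrow> vec_last (x @\<^sub>v y) n = y"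
  by (intro eq_vecI) (auto simp: vec_last_def)

lemma mult_mat_zero_vec: "A \<in> carrier_mat m k \<Longrightarrow> A *\<^sub>v 0\<^sub>v k = (0\<^sub>v m :: 'a :: semiring_0 vec)"
  by (intro eq_vecI) auto

locale invertible_coupling =
  fixes n :: nat and B :: "real mat"
  assumes n_pos: "n \<ge> 1" and B_carrier: "B \<in> carrier_mat n n" and B_invertible: "invertible_mat B"
begin

text \<open>The linear part of the saddle field; the sign of the lower left block makes it
  skew.\<close>

definition coupling :: "real mat" where
  "coupling = four_block_mat (0\<^sub>m n n) B (- transpose_mat B) (0\<^sub>m n n)"

abbreviation Gram :: "real mat" where
  "Gram \<equiv> transpose_mat B * B"

lemma Gram_carrier: "Gram \<in> carrier_mat n n"
  using B_carrier by simp

lemma Gram_symmetric: "transpose_mat Gram = Gram"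
  using B_carrier by (simp add: transpose_mult[of _ n n])

lemma transpose_carrier: "transpose_mat B \<in> carrier_mat n n"
  using B_carrier by simp

lemma Gram_form:
  assumes "v \<in> carrier_vec n"
  shows "v \<bullet> (Gram *\<^sub>v v) = (B *\<^sub>v v) \<bullet> (B *\<^sub>v v)"
  using transpose_vec_mult_scalar[OF transpose_carrier _ assms, of "B *\<^sub>v v"] assms B_carrier
  by (simp add: assoc_mult_mat_vec[of _ n n])

text \<open>\<open>invertible_mat\<close> does not state the shape of the inverse; comparing the
  column counts in both products recovers it.\<close>

lemma two_sided_inverse:
  obtains C where "C \<in> carrier_mat n n" "B * C = 1\<^sub>m n" "C * B = 1\<^sub>m n"
proof -
  obtain C where C: "inverts_mat B C" "inverts_mat C B"
    using B_invertible by (auto simp: invertible_mat_def)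
  have BC: "B * C = 1\<^sub>m n" "C * B = 1\<^sub>m (dim_row C)"
    using C B_carrier by (auto simp: inverts_mat_def)
  have "dim_col C = n"
    using arg_cong[OF BC(1), of dim_col] by simp
  moreover have "dim_row C = n"
    using arg_cong[OF BC(2), of dim_col] B_carrier by simp
  ultimately show ?thesis using BC by (intro that) auto
qed

lemma B_surjective:
  assumes "v \<in> carrier_vec n"
  obtains w where "w \<in> carrier_vec n" "B *\<^sub>v w = v"
proof -
  obtain C where C: "C \<in> carrier_mat n n" "B * C = 1\<^sub>m n" "C * B = 1\<^sub>m n" by (rule two_sided_inverse)
  show ?thesis
    using assms C B_carrier assoc_mult_mat_vec[of B n n C n v] by (intro that[of "C *\<^sub>v v"]) auto
qed

lemma transpose_surjective:
  assumes "v \<in> carrier_vec n"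
  obtains w where "w \<in> carrier_vec n" "transpose_mat B *\<^sub>v w = v"
proof -
  obtain C where C: "C \<in> carrier_mat n n" "B * C = 1\<^sub>m n" "C * B = 1\<^sub>m n" by (rule two_sided_inverse)
  have "transpose_mat B * transpose_mat C = 1\<^sub>m n"
    using C B_carrier transpose_mult[of C n n B n] by simp
  then show ?thesis
    using assms C B_carrier assoc_mult_mat_vec[of "transpose_mat B" n n "transpose_mat C" n v]
    by (intro that[of "transpose_mat C *\<^sub>v v"]) auto
qed

lemma B_injective:
  assumes "v \<in> carrier_vec n" "B *\<^sub>v v = 0\<^sub>v n"
  shows "v = 0\<^sub>v n"
proof -
  obtain C where C: "C \<in> carrier_mat n n" "B * C = 1\<^sub>m n" "C * B = 1\<^sub>m n" by (rule two_sided_inverse)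
  show ?thesis
    using assms C B_carrier assoc_mult_mat_vec[of C n n B n v] by (simp add: mult_mat_zero_vec)
qed

section \<open>Bounds for \<open>B\<close> and its transpose by the extreme eigenvalues of
  \<open>Gram\<close>\<close>

lemma lambda_min_pos: "0 < lambda_min Gram"
proof -
  \<comment> \<open>The minimum is a genuine eigenvalue, as the spectrum is finite and nonempty.
    Injectivity of \<open>B\<close> then makes the form positive at its eigenvector.\<close>
  have "lambda_min Gram \<in> spectrum Gram"
    unfolding lambda_min_def
    using card_finite_spectrum[OF Gram_carrier]
      spectrum_nonempty_symmetric[OF Gram_carrier Gram_symmetric n_pos] by (intro Min_in) auto
  then obtain v where v: "v \<in> carrier_vec n" "v \<noteq> 0\<^sub>v n"
    and ev: "Gram *\<^sub>v v = lambda_min Gram \<cdot>\<^sub>v v"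
    using B_carrier by (auto simp: spectrum_def eigenvalue_def eigenvector_def)
  have "(B *\<^sub>v v) \<bullet> (B *\<^sub>v v) = lambda_min Gram * (v \<bullet> v)"
    using v by (simp add: ev flip: Gram_form)
  moreover have "B *\<^sub>v v \<in> carrier_vec n" using B_carrier v by simp
  then have "(B *\<^sub>v v) \<bullet> (B *\<^sub>v v) \<noteq> 0"
    using v B_injective scalar_prod_self_eq_0_iff by blast
  ultimately show ?thesis
    using scalar_prod_self_nonneg[of v] scalar_prod_self_nonneg[of "B *\<^sub>v v"]
    by (smt (verit) mult_nonneg_nonneg mult_nonpos_nonneg)
qed

lemma lambda_min_le_max: "lambda_min Gram \<le> lambda_max Gram"
  unfolding lambda_min_def lambda_max_def
  using card_finite_spectrum[OF Gram_carrier]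
    spectrum_nonempty_symmetric[OF Gram_carrier Gram_symmetric n_pos]
  by (meson Max_ge Min_in Min_le order_trans)

lemma B_upper: "v \<in> carrier_vec n \<Longrightarrow> (B *\<^sub>v v) \<bullet> (B *\<^sub>v v) \<le> lambda_max Gram * (v \<bullet> v)"
  using lambda_max_bound[OF Gram_carrier Gram_symmetric n_pos] by (simp add: Gram_form)

lemma B_lower: "v \<in> carrier_vec n \<Longrightarrow> lambda_min Gram * (v \<bullet> v) \<le> (B *\<^sub>v v) \<bullet> (B *\<^sub>v v)"
  using lambda_min_bound[OF Gram_carrier Gram_symmetric n_pos] by (simp add: Gram_form)

lemma transpose_upper:
  assumes v: "v \<in> carrier_vec n"
  shows "(transpose_mat B *\<^sub>v v) \<bullet> (transpose_mat B *\<^sub>v v) \<le> lambda_max Gram * (v \<bullet> v)"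
proof -
  define p where "p = transpose_mat B *\<^sub>v v"
  have p: "p \<in> carrier_vec n" using B_carrier v by (simp add: p_def)
  have pp: "p \<bullet> p = v \<bullet> (B *\<^sub>v p)"
    using transpose_vec_mult_scalar[OF B_carrier p v] by (simp add: p_def)
  have Bp: "B *\<^sub>v p \<in> carrier_vec n" using B_carrier p by simp
  have "(p \<bullet> p)\<^sup>2 \<le> (v \<bullet> v) * ((B *\<^sub>v p) \<bullet> (B *\<^sub>v p))"
    using cauchy_schwarz_square[OF v Bp] pp scalar_prod_self_nonneg[of p] by simp
  also have "\<dots> \<le> (v \<bullet> v) * (lambda_max Gram * (p \<bullet> p))"
    using B_upper[OF p] by (intro mult_left_mono) auto
  finally have le: "(p \<bullet> p) * (p \<bullet> p) \<le> (p \<bullet> p) * (lambda_max Gram * (v \<bullet> v))"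
    by (simp add: power2_eq_square algebra_simps)
  show ?thesis
  proof (cases "p \<bullet> p = 0")
    case True
    then show ?thesis
      using lambda_min_pos lambda_min_le_max by (simp add: p_def[symmetric])
  next
    case False
    then have "0 < p \<bullet> p" using scalar_prod_self_nonneg[of p] by linarith
    then show ?thesis using le by (simp add: p_def[symmetric])
  qed
qed

text \<open>Dually, invertibility allows writing \<open>v = B *\<^sub>v w\<close>. Cauchy-Schwarz on
  \<open>v \<bullet> v = p \<bullet> w\<close> and the lower bound for \<open>B\<close> at
  \<open>w\<close> suffice.\<close>

lemma transpose_lower:
  assumes v: "v \<in> carrier_vec n"
  shows "lambda_min Gram * (v \<bullet> v) \<le> (transpose_mat B *\<^sub>v v) \<bullet> (transpose_mat B *\<^sub>v v)"
proof (cases "v \<bullet> v = 0")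
  case True
  then show ?thesis by simp
next
  case False
  then have pos: "0 < v \<bullet> v" using scalar_prod_self_nonneg[of v] by linarith
  define p where "p = transpose_mat B *\<^sub>v v"
  obtain w where w: "w \<in> carrier_vec n" "B *\<^sub>v w = v" using B_surjective[OF v] by blast
  have p: "p \<in> carrier_vec n" using B_carrier v by (simp add: p_def)
  have vv: "v \<bullet> v = p \<bullet> w"
    using transpose_vec_mult_scalar[OF B_carrier w(1) v] w(2) by (simp add: p_def)
  have "lambda_min Gram * (v \<bullet> v)\<^sup>2 \<le> lambda_min Gram * ((p \<bullet> p) * (w \<bullet> w))"
    using cauchy_schwarz_square[OF p w(1)] vv pos lambda_min_pos by (intro mult_left_mono) auto
  also have "\<dots> \<le> (p \<bullet> p) * (v \<bullet> v)"
    using mult_left_mono[OF B_lower[OF w(1)] scalar_prod_self_nonneg[of p]] w(2)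
    by (simp add: algebra_simps)
  finally have "(v \<bullet> v) * (lambda_min Gram * (v \<bullet> v)) \<le> (v \<bullet> v) * (p \<bullet> p)"
    by (simp add: power2_eq_square algebra_simps)
  then show ?thesis using pos by (simp add: p_def)
qed

section \<open>The skew block matrix\<close>

lemma coupling_carrier: "coupling \<in> carrier_mat (n + n) (n + n)"
  using B_carrier by (simp add: coupling_def)

lemma split_vec:
  assumes "z \<in> carrier_vec (n + n)"
  obtains x y where "x \<in> carrier_vec n" "y \<in> carrier_vec n" "z = x @\<^sub>v y"
    "vec_first z n = x" "vec_last z n = y"
  using assms vec_first_last_append[of z n n] by (metis vec_first_carrier vec_last_carrier)

lemma coupling_append:
  assumes "x \<in> carrier_vec n" "y \<in> carrier_vec n"
  shows "coupling *\<^sub>v (x @\<^sub>v y) = (B *\<^sub>v y) @\<^sub>v (- (transpose_mat B *\<^sub>v x))"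
  unfolding coupling_def using assms B_carrier
  by (subst four_block_mat_mult_vec[of _ n n _ n _ n]) auto

lemma coupling_skew:
  assumes "z \<in> carrier_vec (n + n)"
  shows "z \<bullet> (coupling *\<^sub>v z) = 0"
proof -
  obtain x y where xy: "x \<in> carrier_vec n" "y \<in> carrier_vec n" and z: "z = x @\<^sub>v y"
    using split_vec[OF assms] .
  have "x \<bullet> (B *\<^sub>v y) = y \<bullet> (transpose_mat B *\<^sub>v x)"
    using transpose_vec_mult_scalar[OF B_carrier xy(2,1)] comm_scalar_prod[of y n] xy B_carrier by simp
  then show ?thesis
    using xy B_carrier by (simp add: z coupling_append scalar_prod_append[of _ n _ n])
qed

lemma coupling_upper:
  assumes "z \<in> carrier_vec (n + n)"
  shows "(coupling *\<^sub>v z) \<bullet> (coupling *\<^sub>v z) \<le> lambda_max Gram * (z \<bullet> z)"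
proof -
  obtain x y where xy: "x \<in> carrier_vec n" "y \<in> carrier_vec n" and z: "z = x @\<^sub>v y"
    using split_vec[OF assms] .
  show ?thesis
    using xy B_carrier add_mono[OF B_upper[OF xy(2)] transpose_upper[OF xy(1)]]
    by (simp add: z coupling_append scalar_prod_append[of _ n _ n] algebra_simps)
qed

lemma coupling_lower:
  assumes "z \<in> carrier_vec (n + n)"
  shows "lambda_min Gram * (z \<bullet> z) \<le> (coupling *\<^sub>v z) \<bullet> (coupling *\<^sub>v z)"
proof -
  obtain x y where xy: "x \<in> carrier_vec n" "y \<in> carrier_vec n" and z: "z = x @\<^sub>v y"
    using split_vec[OF assms] .
  show ?thesis
    using xy B_carrier add_mono[OF B_lower[OF xy(2)] transpose_lower[OF xy(1)]]
    by (simp add: z coupling_append scalar_prod_append[of _ n _ n] algebra_simps)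
qed

lemma L_H_pos: "0 < L_H B"
  using lambda_min_pos lambda_min_le_max by (simp add: L_H_def)

lemma L_H_square: "(L_H B)\<^sup>2 = lambda_max Gram"
  using lambda_min_pos lambda_min_le_max by (simp add: L_H_def)

sublocale skew_bounded coupling "n + n" "L_H B"
  by unfold_locales (simp_all add: coupling_carrier coupling_skew coupling_upper L_H_pos L_H_square)

text \<open>Testing the saddle inequalities at one gradient step from the saddle point shows that
  the gradient vanishes there.\<close>

lemma saddle_point_append_iff:
  assumes ux: "ux \<in> carrier_vec n" and uy: "uy \<in> carrier_vec n"
    and x: "x \<in> carrier_vec n" and y: "y \<in> carrier_vec n"
  shows "saddle_point n B ux uy (x @\<^sub>v y)
    \<longleftrightarrow> B *\<^sub>v y + ux = 0\<^sub>v n \<and> transpose_mat B *\<^sub>v x + uy = 0\<^sub>v n"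
proof -
  \<comment> \<open>\<open>g\<close> and \<open>k\<close> are the partial gradients of the
    objective, which is affine in each argument separately.\<close>
  define g where "g = B *\<^sub>v y + ux"
  define k where "k = transpose_mat B *\<^sub>v x + uy"
  have g: "g \<in> carrier_vec n" and k: "k \<in> carrier_vec n"
    using B_carrier ux uy x y by (auto simp: g_def k_def)
  have obj_x: "objective B ux uy a y = a \<bullet> g + uy \<bullet> y" if "a \<in> carrier_vec n" for a
    using that ux y B_carrier
    by (simp add: objective_def g_def scalar_prod_add_distrib[of _ n])
  have obj_y: "objective B ux uy x b = k \<bullet> b + x \<bullet> ux" if b: "b \<in> carrier_vec n" for b
    using b uy x B_carrier transpose_vec_mult_scalar[OF B_carrier b x]
    by (simp add: objective_def k_def add_scalar_prod_distrib[of _ n])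
  have saddle: "saddle_point n B ux uy (x @\<^sub>v y) \<longleftrightarrow>
     (\<forall>a \<in> carrier_vec n. \<forall>b \<in> carrier_vec n. k \<bullet> b \<le> k \<bullet> y \<and> x \<bullet> g \<le> a \<bullet> g)"
    unfolding saddle_point_def
    using x y by (simp add: vec_first_append vec_last_append)
      (smt (verit) obj_x obj_y)
  show ?thesis unfolding saddle g_def[symmetric] k_def[symmetric]
  proof
    assume *: "\<forall>a \<in> carrier_vec n. \<forall>b \<in> carrier_vec n. k \<bullet> b \<le> k \<bullet> y \<and> x \<bullet> g \<le> a \<bullet> g"
    have "x \<bullet> g \<le> (x - g) \<bullet> g" "k \<bullet> (y + k) \<le> k \<bullet> y"
      using * x y g k by auto
    then have "g \<bullet> g \<le> 0" "k \<bullet> k \<le> 0"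
      using x y g k by (simp_all add: minus_scalar_prod_distrib[of _ n] scalar_prod_add_distrib[of _ n])
    then show "g = 0\<^sub>v n \<and> k = 0\<^sub>v n"
      using g k scalar_prod_self_eq_0_iff scalar_prod_self_nonneg[of g] scalar_prod_self_nonneg[of k]
      by (metis order_antisym)
  qed (use x y in auto)
qed

lemma ex_saddle_point:
  assumes ux: "ux \<in> carrier_vec n" and uy: "uy \<in> carrier_vec n"
  shows "\<exists>z. saddle_point n B ux uy z"
proof -
  obtain y where y: "y \<in> carrier_vec n" "B *\<^sub>v y = - ux"
    using B_surjective[of "- ux"] ux by auto
  obtain x where x: "x \<in> carrier_vec n" "transpose_mat B *\<^sub>v x = - uy"
    using transpose_surjective[of "- uy"] uy by auto
  show ?thesis
    using saddle_point_append_iff[OF ux uy x(1) y(1)] x y ux uy by auto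
qed

text \<open>Both gradients vanish at \<open>zs\<close>, so \<open>ux\<close> and \<open>uy\<close>
  are minus the linear terms there, and the affine field becomes linear in
  \<open>z - zs\<close>.\<close>

lemma H_field_eq_coupling:
  assumes ux: "ux \<in> carrier_vec n" and uy: "uy \<in> carrier_vec n"
    and saddle: "saddle_point n B ux uy zs" and z: "z \<in> carrier_vec (n + n)"
  shows "H_field n B ux uy z = coupling *\<^sub>v (z - zs)"
proof -
  have zs: "zs \<in> carrier_vec (n + n)" using saddle by (simp add: saddle_point_def)
  obtain x y where xy: "x \<in> carrier_vec n" "y \<in> carrier_vec n" and z_eq: "z = x @\<^sub>v y"
    using split_vec[OF z] .
  obtain xs ys where s: "xs \<in> carrier_vec n" "ys \<in> carrier_vec n" and zs_eq: "zs = xs @\<^sub>v ys"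
    using split_vec[OF zs] .
  have 0: "B *\<^sub>v ys + ux = 0\<^sub>v n" "transpose_mat B *\<^sub>v xs + uy = 0\<^sub>v n"
    using saddle_point_append_iff[OF ux uy s] saddle zs_eq by auto
  have carr: "B *\<^sub>v ys \<in> carrier_vec n" "B *\<^sub>v y \<in> carrier_vec n"
    "transpose_mat B *\<^sub>v x \<in> carrier_vec n" "transpose_mat B *\<^sub>v xs \<in> carrier_vec n"
    using B_carrier xy s by auto
  have u: "ux = - (B *\<^sub>v ys)" "uy = - (transpose_mat B *\<^sub>v xs)"
    using 0 ux uy carr B_carrier by (auto simp: vec_eq_iff add_eq_0_iff simp del: index_mult_mat_vec)
  have "z - zs = (x - xs) @\<^sub>v (y - ys)"
    using xy s by (intro eq_vecI) (auto simp: z_eq zs_eq)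
  then have "coupling *\<^sub>v (z - zs)
      = (B *\<^sub>v y - B *\<^sub>v ys) @\<^sub>v (- (transpose_mat B *\<^sub>v x - transpose_mat B *\<^sub>v xs))"
    using xy s B_carrier
    by (simp add: coupling_append mult_minus_distrib_mat_vec[of _ n n])
  also have "B *\<^sub>v y - B *\<^sub>v ys = B *\<^sub>v y + ux"
    using carr ux by (simp add: u(1) minus_add_uminus_vec[of _ n])
  also have "- (transpose_mat B *\<^sub>v x - transpose_mat B *\<^sub>v xs) = - (transpose_mat B *\<^sub>v x) - uy"
    unfolding u(2) using carr
    by (intro eq_vecI) (auto simp del: index_mult_mat_vec)
  finally show ?thesis
    using xy by (simp add: H_field_def z_eq vec_first_append vec_last_append)
qed

text \<open>Expanding the field at \<open>z\<close> around either saddle point gives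
  \<open>coupling\<close> applied to \<open>z - w\<close> and to zero; the lower bound for
  \<open>coupling\<close> forces \<open>z = w\<close>.\<close>

lemma saddle_point_unique:
  assumes ux: "ux \<in> carrier_vec n" and uy: "uy \<in> carrier_vec n"
    and s: "saddle_point n B ux uy z" and t: "saddle_point n B ux uy w"
  shows "z = w"
proof -
  have c: "z \<in> carrier_vec (n + n)" "w \<in> carrier_vec (n + n)"
    using s t by (auto simp: saddle_point_def)
  then have d: "z - w \<in> carrier_vec (n + n)" by simp
  have "coupling *\<^sub>v (z - w) = coupling *\<^sub>v (z - z)"
    using H_field_eq_coupling[OF ux uy s c(1)] H_field_eq_coupling[OF ux uy t c(1)] by simp
  also have "\<dots> = 0\<^sub>v (n + n)"
    using c coupling_carrier by (simp add: mult_mat_zero_vec)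
  finally have "lambda_min Gram * ((z - w) \<bullet> (z - w)) \<le> 0"
    using coupling_lower[OF d] by simp
  then have "(z - w) \<bullet> (z - w) \<le> 0"
    using lambda_min_pos by (simp add: mult_le_0_iff)
  then have "z - w = 0\<^sub>v (n + n)"
    using scalar_prod_self_eq_0_iff[OF d] scalar_prod_self_nonneg[of "z - w"] by linarith
  then show "z = w"
    using c by (auto simp: vec_eq_iff)
qed

text \<open>The smallest eigenvalue turns the residual bound into a distance bound, and squaring
  \<open>8 * L_H B\<close> yields the factor 64. The carrier statement is what allows epochs to be
  chained.\<close>

lemma z_ag_bound:
  assumes ux: "ux \<in> carrier_vec n" and uy: "uy \<in> carrier_vec n"
    and saddle: "saddle_point n B ux uy zs" and z0: "z0 \<in> carrier_vec (n + n)" and K: "K \<ge> 1"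
  shows "z_ag n B ux uy z0 K \<in> carrier_vec (n + n)"
    and "(euclidean_norm (z_ag n B ux uy z0 K - zs))\<^sup>2
      \<le> 64 * lambda_max Gram / (lambda_min Gram * (real K + 1)\<^sup>2) * (euclidean_norm (z0 - zs))\<^sup>2"
proof -
  have zs: "zs \<in> carrier_vec (n + n)" using saddle by (simp add: saddle_point_def)
  obtain z h a where "iterates (H_field n B ux uy) (\<lambda>_. 1 / (2 * L_H B)) (\<lambda>k. 2 / (real k + 2)) z0 K
      = (z, h, a)" by (metis prod_cases3)
  note it = this iterates_eq_iters[OF H_field_eq_coupling[OF ux uy saddle] zs z0 this]
  then have a: "z_ag n B ux uy z0 K = a" "a \<in> carrier_vec (n + n)"
    and iters: "snd (snd (iters (z0 - zs) K)) = a - zs"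
    by (simp_all add: z_ag_def)
  then show "z_ag n B ux uy z0 K \<in> carrier_vec (n + n)" by simp
  have "lambda_min Gram * (euclidean_norm (a - zs))\<^sup>2 \<le> (euclidean_norm (coupling *\<^sub>v (a - zs)))\<^sup>2"
    using coupling_lower[of "a - zs"] a zs by (simp add: euclidean_norm_square)
  also have "\<dots> \<le> (8 * L_H B / (real K + 1) * euclidean_norm (z0 - zs))\<^sup>2"
    using iters_average_residual[of "z0 - zs" K] z0 zs K by (intro power_mono) (auto simp: iters)
  also have "\<dots> = 64 * lambda_max Gram / (real K + 1)\<^sup>2 * (euclidean_norm (z0 - zs))\<^sup>2"
    by (simp add: power_mult_distrib power_divide flip: L_H_square)
  finally show "(euclidean_norm (z_ag n B ux uy z0 K - zs))\<^sup>2
      \<le> 64 * lambda_max Gram / (lambda_min Gram * (real K + 1)\<^sup>2) * (euclidean_norm (z0 - zs))\<^sup>2"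
    using lambda_min_pos by (simp add: a field_simps)
qed

end

section \<open>Scheduled restarting\<close>

context invertible_coupling
begin

text \<open>The condition number of \<open>B\<close>, i.e. the ratio of its extreme singular
  values.\<close>

definition \<kappa> :: real where
  "\<kappa> = sqrt (lambda_max Gram / lambda_min Gram)"

lemma \<kappa>_ge_1: "1 \<le> \<kappa>"
  using lambda_min_pos lambda_min_le_max by (simp add: \<kappa>_def)

lemma \<kappa>_square: "\<kappa>\<^sup>2 = lambda_max Gram / lambda_min Gram"
  using lambda_min_pos lambda_min_le_max by (simp add: \<kappa>_def)

lemma epoch_halves:
  assumes "ux \<in> carrier_vec n" "uy \<in> carrier_vec n" "saddle_point n B ux uy zs"
    "z0 \<in> carrier_vec (n + n)" "K \<ge> 1" and K: "16 * \<kappa> \<le> real K + 1"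
  shows "euclidean_norm (z_ag n B ux uy z0 K - zs) \<le> euclidean_norm (z0 - zs) / 2"
proof -
  \<comment> \<open>The 16 is chosen so that the contraction factor for squared distances is at most
    64 / 256 = 1/4.\<close>
  have "(16 * \<kappa>)\<^sup>2 \<le> (real K + 1)\<^sup>2"
    using K \<kappa>_ge_1 by (intro power_mono) auto
  then have "64 * \<kappa>\<^sup>2 / (real K + 1)\<^sup>2 \<le> 1 / 4"
    by (simp add: divide_le_eq power_mult_distrib)
  then have "64 * lambda_max Gram / (lambda_min Gram * (real K + 1)\<^sup>2) \<le> 1 / 4"
    by (simp add: \<kappa>_square)
  then have "(euclidean_norm (z_ag n B ux uy z0 K - zs))\<^sup>2 \<le> 1 / 4 * (euclidean_norm (z0 - zs))\<^sup>2"
    using z_ag_bound(2)[OF assms(1-5)] by (meson mult_right_mono order_trans zero_le_power2)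
  then have "(euclidean_norm (z_ag n B ux uy z0 K - zs))\<^sup>2 \<le> (euclidean_norm (z0 - zs) / 2)\<^sup>2"
    by (simp add: power_divide)
  then show ?thesis by (rule power2_le_imp_le) simp
qed

lemma restarted_replicate:
  assumes "ux \<in> carrier_vec n" "uy \<in> carrier_vec n" "saddle_point n B ux uy zs"
    "z0 \<in> carrier_vec (n + n)" "K \<ge> 1" "16 * \<kappa> \<le> real K + 1"
  shows "euclidean_norm (restarted n B ux uy z0 (replicate N K) - zs) \<le> euclidean_norm (z0 - zs) / 2 ^ N"
  using assms(4)
proof (induction N arbitrary: z0)
  case 0
  then show ?case by (simp add: restarted_def)
next
  case (Suc N)
  have "euclidean_norm (restarted n B ux uy z0 (replicate (Suc N) K) - zs)
      \<le> euclidean_norm (z_ag n B ux uy z0 K - zs) / 2 ^ N"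
    using Suc.IH[OF z_ag_bound(1)[OF assms(1-3) Suc.prems assms(5)]] by (simp add: restarted_def)
  also have "\<dots> \<le> euclidean_norm (z0 - zs) / 2 / 2 ^ N"
    using epoch_halves[OF assms(1-3) Suc.prems assms(5,6)] by (intro divide_right_mono) auto
  finally show ?case by simp
qed

text \<open>All epochs have equal length, at most \<open>17 * \<kappa>\<close> because
  \<open>\<kappa> \<ge> 1\<close> absorbs the rounding. At most
  \<open>4 * ln (1 / \<epsilon>)\<close> of them are used, whence 68 = 4 * 17.\<close>

lemma restart_complexity:
  assumes u: "ux \<in> carrier_vec n" "uy \<in> carrier_vec n" and saddle: "saddle_point n B ux uy zs"
    and z0: "z0 \<in> carrier_vec (n + n)"
  shows "\<forall>\<^sub>F \<epsilon> in at_right (0::real). \<exists>Ks::nat list. Ks \<noteq> [] \<and> (\<forall>K\<in>set Ks. K \<ge> 1) \<and>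
    euclidean_norm (restarted n B ux uy z0 Ks - zs) \<le> \<epsilon> \<and>
    real (sum_list Ks) \<le> 68 * (\<kappa> * ln (1 / \<epsilon>))"
proof -
  define R where "R = euclidean_norm (z0 - zs)"
  have R: "0 \<le> R" by (simp add: R_def)
  define K where "K = nat \<lceil>16 * \<kappa>\<rceil>"
  have K: "16 * \<kappa> \<le> real K" "real K \<le> 17 * \<kappa>" "K \<ge> 1"
    using \<kappa>_ge_1 unfolding K_def by linarith+
  \<comment> \<open>Below this threshold \<open>ln (1 / \<epsilon>)\<close> exceeds
    \<open>ln (R + 1) + 1\<close>, so the initial distance is absorbed and the constant does not
    depend on it. Using \<open>R + 1\<close> keeps the logarithm defined and nonnegative for
    \<open>R = 0\<close>.\<close>
  have "\<forall>\<^sub>F \<epsilon> in at_right (0::real). 0 < \<epsilon> \<and> \<epsilon> < exp (- (ln (R + 1) + 1))"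
    unfolding eventually_at_right_field by (intro exI[of _ "exp (- (ln (R + 1) + 1))"]) auto
  then show ?thesis
  proof eventually_elim
    case (elim \<epsilon>)
    have "ln \<epsilon> < - (ln (R + 1) + 1)"
      using elim by (metis exp_less_cancel_iff exp_ln)
    then have \<epsilon>: "ln (R + 1) + 1 < ln (1 / \<epsilon>)"
      using elim by (simp add: ln_div)
    define t where "t = log 2 ((R + 1) / \<epsilon>)"
    define N where "N = nat \<lceil>t\<rceil>"
    have t_ln: "t * ln 2 = ln (R + 1) + ln (1 / \<epsilon>)"
      using elim R by (simp add: t_def log_def ln_div)
    have lnR: "0 \<le> ln (R + 1)" using R by simp
    then have "0 < t * ln 2" using \<epsilon> t_ln by linarith
    then have t_pos: "0 < t" by (simp add: zero_less_mult_iff)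
    have "1 / 2 \<le> ln (2 :: real)"
      using ln_le_minus_one[of "1 / 2 :: real"] by (simp add: ln_div)
    then have "t * (1 / 2) \<le> t * ln 2"
      using t_pos by (intro mult_left_mono) auto
    \<comment> \<open>Rounding up gives \<open>N < t + 1\<close>, and \<open>t\<close> is at most
      \<open>2 * (ln (R + 1) + ln (1 / \<epsilon>))\<close>; the threshold brings the sum below
      \<open>4 * ln (1 / \<epsilon>)\<close>.\<close>
    then have N: "real N \<le> 4 * ln (1 / \<epsilon>)" "N \<ge> 1"
      using t_ln t_pos \<epsilon> lnR unfolding N_def by linarith+
    have "(R + 1) / \<epsilon> = 2 powr t"
      using elim R by (simp add: t_def)
    also have "\<dots> \<le> 2 powr real N"
      using t_pos by (intro powr_mono) (auto simp: N_def)
    finally have "(R + 1) / \<epsilon> \<le> 2 ^ N" by (simp add: powr_realpow)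
    then have "R + 1 \<le> \<epsilon> * 2 ^ N" using elim by (simp add: field_simps)
    then have "R / 2 ^ N \<le> \<epsilon>" by (simp add: divide_le_eq)
    then have "euclidean_norm (restarted n B ux uy z0 (replicate N K) - zs) \<le> \<epsilon>"
      using restarted_replicate[OF u saddle z0 K(3), of N] K(1) by (simp add: R_def)
    moreover have "real N * real K \<le> (4 * ln (1 / \<epsilon>)) * (17 * \<kappa>)"
      using N K by (intro mult_mono) auto
    ultimately show ?case
      using N K by (intro exI[of _ "replicate N K"]) (auto simp: sum_list_replicate mult_ac)
  qed
qed

end

lemma bilinear_problem_iff:
  "bilinear_problem n B ux uy \<longleftrightarrow>
    invertible_coupling n B \<and> ux \<in> carrier_vec n \<and> uy \<in> carrier_vec n"
  by (auto simp: bilinear_problem_def invertible_coupling_def)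

text \<open>The first conjunct ensures that \<open>zs\<close> in the other two denotes one definite
  point. \<open>C\<close> is fixed before the dimension and the data, whereas the threshold for
  \<epsilon> may depend on them.\<close>

theorem theorem3p6:
  shows
    "(\<forall>n B ux uy. bilinear_problem n B ux uy \<longrightarrow> (\<exists>!zs. saddle_point n B ux uy zs)) \<and>
     (\<forall>n B ux uy zs z0 K.
        bilinear_problem n B ux uy \<longrightarrow> saddle_point n B ux uy zs \<longrightarrow>
        z0 \<in> carrier_vec (n + n) \<longrightarrow> K \<ge> 1 \<longrightarrow>
        (euclidean_norm (z_ag n B ux uy z0 K - zs))\<^sup>2
          \<le> 64 * lambda_max (transpose_mat B * B)
              / (lambda_min (transpose_mat B * B) * (real K + 1)\<^sup>2)
              * (euclidean_norm (z0 - zs))\<^sup>2) \<and>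
     (\<exists>C::real. \<forall>n B ux uy zs z0.
        bilinear_problem n B ux uy \<longrightarrow> saddle_point n B ux uy zs \<longrightarrow>
        z0 \<in> carrier_vec (n + n) \<longrightarrow>
        (\<forall>\<^sub>F \<epsilon> in at_right (0::real).
           \<exists>Ks::nat list. Ks \<noteq> [] \<and> (\<forall>K\<in>set Ks. K \<ge> 1) \<and>
             euclidean_norm (restarted n B ux uy z0 Ks - zs) \<le> \<epsilon> \<and>
             real (sum_list Ks)
               \<le> C * (sqrt (lambda_max (transpose_mat B * B) / lambda_min (transpose_mat B * B))
                       * ln (1 / \<epsilon>))))"
proof (intro conjI allI impI exI[of _ 68])
  fix n B ux uy
  assume "bilinear_problem n B ux uy"
  then interpret invertible_coupling n B by (simp add: bilinear_problem_iff)
  have "ux \<in> carrier_vec n" "uy \<in> carrier_vec n"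
    using \<open>bilinear_problem n B ux uy\<close> by (simp_all add: bilinear_problem_iff)
  then show "\<exists>!zs. saddle_point n B ux uy zs"
    using ex_saddle_point saddle_point_unique by blast
next
  fix n B ux uy zs and z0 :: "real vec" and K :: nat
  assume *: "bilinear_problem n B ux uy" "saddle_point n B ux uy zs"
    "z0 \<in> carrier_vec (n + n)" "K \<ge> 1"
  then interpret invertible_coupling n B by (simp add: bilinear_problem_iff)
  show "(euclidean_norm (z_ag n B ux uy z0 K - zs))\<^sup>2
          \<le> 64 * lambda_max (transpose_mat B * B)
              / (lambda_min (transpose_mat B * B) * (real K + 1)\<^sup>2)
              * (euclidean_norm (z0 - zs))\<^sup>2"
    using * by (intro z_ag_bound(2)) (auto simp: bilinear_problem_iff)
next
  fix n B ux uy zs and z0 :: "real vec"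
  assume *: "bilinear_problem n B ux uy" "saddle_point n B ux uy zs" "z0 \<in> carrier_vec (n + n)"
  then interpret invertible_coupling n B by (simp add: bilinear_problem_iff)
  show "\<forall>\<^sub>F \<epsilon> in at_right (0::real).
           \<exists>Ks::nat list. Ks \<noteq> [] \<and> (\<forall>K\<in>set Ks. K \<ge> 1) \<and>
             euclidean_norm (restarted n B ux uy z0 Ks - zs) \<le> \<epsilon> \<and>
             real (sum_list Ks)
               \<le> 68 * (sqrt (lambda_max (transpose_mat B * B) / lambda_min (transpose_mat B * B))
                       * ln (1 / \<epsilon>))"
    using restart_complexity * by (simp add: bilinear_problem_iff \<kappa>_def)
qed

end
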